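(* Let $T>0$, $T_1\in(0,T)$, $\gamma>0$, let $\Delta_h\in\mathbb{R}^{m\times m}$ be the discrete Laplacian with homogeneous Dirichlet boundary conditions, let $f,g\in L^2(0,T;\mathbb{R}^m)$ and $y_0\in\mathbb{R}^m$. Let $(y,p):[0,T]\to\mathbb{R}^m\times\mathbb{R}^m$ be the solution of the semi-discretized optimality system $$-\partial_t y+\Delta_h y-p/\gamma=f,\quad \partial_t p+\Delta_h p+y=g\ \text{ on }(0,T),\qquad y(0)=y_0,\quad p(T)=0.$$ Given an arbitrary initial guess $p_2^0(T_1)\in\mathbb{R}^m$, let the iterates of the multiplicative Schwarz algorithm without overlap (MSN) be defined for $k=1,2,\dots$ by solving successively $$\left\{\begin{array}{ll} -\partial_t y_1^k+\Delta_h y_1^k-p_1^k/\gamma=f & \text{on }(0,T_1),\quad y_1^k(0)=y_0,\\ \partial_t p_1^k+\Delta_h p_1^k+y_1^k=g & \text{on }(0,T_1),\quad p_1^k(T_1)=p_2^{k-1}(T_1), \end{array}\right.$$ $$\left\{\begin{array}{ll} -\partial_t y_2^k+\Delta_h y_2^k-p_2^k/\gamma=f & \text{on }(T_1,T),\quad y_2^k(T_1)=y_1^{k}(T_1),\\ \partial_t p_2^k+\Delta_h p_2^k+y_2^k=g & \text{on }(T_1,T),\quad p_2^k(T)=0. \end{array}\right.$$ Then the MSN algorithm is convergent: for any initial guess, as $k\to\infty$, $y_1^k(t)\to y(t)$ and $p_1^k(t)\to p(t)$ for every $t\in[0,T_1]$, and $y_2^k(t)\to y(t)$ and $p_2^k(t)\to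 p(t)$ for every $t\in[T_1,T]$.
   Context: The spatial domain is $\Omega=(0,1)^d$, $d\in\{1,2,3\}$, with a uniform grid of mesh size $h=1/M$, $M\ge2$ an integer, and $m=(M-1)^d$ interior grid points. $\Delta_h$ is the matrix, acting on vectors of interior grid values, of the standard second-order central difference Laplacian ($(\Delta_h Z)_i=h^{-2}\sum_{j\sim i}(Z_j-Z_i)$, the sum being over the $2d$ nearest grid neighbours $j$ of the interior point $i$, with $Z_j=0$ at boundary points); for $d=2$ this is the 5-point stencil. Time is kept continuous. Solutions of the ODE systems are absolutely continuous vector functions on the respective closed time intervals satisfying the equations almost everywhere; the global system and the subdomain systems are understood to be uniquely solvable. *)

theory Defs
  imports "HOL-Analysis.Analysis"
begin

text \<open>
  The grid point with coordinates \<open>h * i!0, ..., h * i!(d-1)\<close>, where \<open>h = 1/M\<close>, is represented by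
  the list \<open>i\<close> of its integer indices. The boundary points are those with an index \<open>0\<close> or \<open>M\<close>.
\<close>

definition interior_grid :: "nat \<Rightarrow> nat \<Rightarrow> nat list set" where
  "interior_grid d M = {i. length i = d \<and> set i \<subseteq> {0<..<M}}"

text \<open>Used only for interior \<open>i\<close>, where every \<open>i!k\<close> is positive and the subtraction is not truncated.\<close>

definition grid_neighbours :: "nat list \<Rightarrow> nat list set" where
  "grid_neighbours i = (\<Union>k<length i. {i[k := i ! k + 1], i[k := i ! k - 1]})"

text \<open>
  Below, \<open>\<nu>\<close> is a numbering of the interior grid points by the index type of the vectors,
  a bijection from \<open>UNIV\<close> onto \<open>interior_grid d M\<close>; it fixes how grid functions are written
  as elements of \<open>real ^ 'n\<close> (so that \<open>CARD('n) = (M - 1) ^ d\<close>).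
\<close>

definition grid_value :: "('n::finite \<Rightarrow> nat list) \<Rightarrow> real ^ 'n \<Rightarrow> nat list \<Rightarrow> real" where
  "grid_value \<nu> Z j = (if j \<in> range \<nu> then Z $ inv \<nu> j else 0)"

definition laplacian_stencil :: "nat \<Rightarrow> ('n::finite \<Rightarrow> nat list) \<Rightarrow> real ^ 'n \<Rightarrow> real ^ 'n" where
  "laplacian_stencil M \<nu> Z =
     (\<chi> r. (\<Sum>j\<in>grid_neighbours (\<nu> r). grid_value \<nu> Z j - Z $ r) / (1 / real M)\<^sup>2)"

definition discrete_laplacian :: "nat \<Rightarrow> ('n::finite \<Rightarrow> nat list) \<Rightarrow> real ^ 'n ^ 'n" where
  "discrete_laplacian M \<nu> = matrix (laplacian_stencil M \<nu>)"

lemma linear_laplacian_stencil: "linear (laplacian_stencil M \<nu>)"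
proof (rule linearI)
  fix Z W
  have "grid_value \<nu> (Z + W) j - (Z + W) $ r =
      (grid_value \<nu> Z j - Z $ r) + (grid_value \<nu> W j - W $ r)" for j r
    by (simp add: grid_value_def)
  then show "laplacian_stencil M \<nu> (Z + W) = laplacian_stencil M \<nu> Z + laplacian_stencil M \<nu> W"
    by (simp only: laplacian_stencil_def vec_eq_iff vec_lambda_beta vector_add_component
        sum.distrib add_divide_distrib) simp
next
  fix c Z
  have "grid_value \<nu> (c *\<^sub>R Z) j - (c *\<^sub>R Z) $ r = c * (grid_value \<nu> Z j - Z $ r)" for j r
    by (simp add: grid_value_def right_diff_distrib)
  then show "laplacian_stencil M \<nu> (c *\<^sub>R Z) = c *\<^sub>R laplacian_stencil M \<nu> Z"
    by (simp only: laplacian_stencil_def vec_eq_iff vec_lambda_beta vector_scaleR_component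
        sum_distrib_left[symmetric]) simp
qed

lemma discrete_laplacian_mult_vec: "discrete_laplacian M \<nu> *v Z = laplacian_stencil M \<nu> Z"
  unfolding discrete_laplacian_def by (metis linear_laplacian_stencil matrix_vector_mul(2))

text \<open>The library's \<open>absolutely_continuous\<close> is about measures, hence this \<open>\<epsilon>\<close>-\<open>\<delta>\<close> definition.\<close>

definition abs_continuous_on :: "real set \<Rightarrow> (real \<Rightarrow> 'a::metric_space) \<Rightarrow> bool" where
  "abs_continuous_on S F \<longleftrightarrow>
     (\<forall>\<epsilon>>0. \<exists>\<delta>>0. \<forall>(n::nat) u v.
        (\<forall>i<n. u i \<le> v i \<and> {u i..v i} \<subseteq> S) \<longrightarrow>
        disjoint_family_on (\<lambda>i. {u i<..<v i}) {..<n} \<longrightarrow>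
        (\<Sum>i<n. v i - u i) < \<delta> \<longrightarrow>
        (\<Sum>i<n. dist (F (u i)) (F (v i))) < \<epsilon>)"

definition square_integrable_on :: "(real \<Rightarrow> 'a::euclidean_space) \<Rightarrow> real set \<Rightarrow> bool" where
  "square_integrable_on f S \<longleftrightarrow>
     set_borel_measurable lebesgue S f \<and> set_integrable lebesgue S (\<lambda>t. (norm (f t))\<^sup>2)"

text \<open>
  Caratheodory solutions on \<open>[a,b]\<close> of
  \<open>- y' + L y - p / \<gamma> = f\<close>, \<open>p' + L p + y = g\<close>; values outside \<open>[a,b]\<close> play no role.
\<close>

definition optimality_solution ::
  "real ^ 'n ^ 'n \<Rightarrow> real \<Rightarrow> (real \<Rightarrow> real ^ 'n) \<Rightarrow> (real \<Rightarrow> real ^ 'n) \<Rightarrow> real \<Rightarrow> real \<Rightarrow>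
    (real \<Rightarrow> real ^ 'n) \<Rightarrow> (real \<Rightarrow> real ^ 'n) \<Rightarrow> bool" where
  "optimality_solution L \<gamma> f g a b y p \<longleftrightarrow>
     abs_continuous_on {a..b} y \<and> abs_continuous_on {a..b} p \<and>
     (AE t in lebesgue. t \<in> {a<..<b} \<longrightarrow>
        (\<exists>y' p'. (y has_vector_derivative y') (at t) \<and> (p has_vector_derivative p') (at t) \<and>
           - y' + L *v y t - p t /\<^sub>R \<gamma> = f t \<and>
           p' + L *v p t + y t = g t))"

end

theory Submission
  imports Defs
begin

text \<open>
  The errors \<open>e = y\<^sub>j\<^sup>k - y\<close> and \<open>q = p\<^sub>j\<^sup>k - p\<close> solve \<open>e' = L e - q / \<gamma>\<close>, \<open>q' = - L q - e\<close>
  with \<open>L = \<Delta>\<^sub>h\<close>, at first almost everywhere and then, by absolute continuity, everywhere.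
  Since \<open>L\<close> is negative definite, \<open>(1 + c) |e|\<^sup>2 - (1 - c) |q|\<^sup>2 / \<gamma>\<close> is nonincreasing in time for
  small \<open>c \<ge> 0\<close>. On \<open>[0, T\<^sub>1]\<close>, where \<open>e(0) = 0\<close>, this gives
  \<open>|e(T\<^sub>1)|\<^sup>2 \<le> \<rho> |q(T\<^sub>1)|\<^sup>2 / \<gamma>\<close> with \<open>\<rho> = (1 - c) / (1 + c) < 1\<close>; on \<open>[T\<^sub>1, T]\<close>, where
  \<open>q(T) = 0\<close>, the case \<open>c = 0\<close> gives \<open>|q(T\<^sub>1)|\<^sup>2 / \<gamma> \<le> |e(T\<^sub>1)|\<^sup>2\<close>. So the interface errors
  decay geometrically, and a Gronwall estimate starting from \<open>T\<^sub>1\<close> carries this to all times.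
\<close>

section \<open>Absolutely continuous functions\<close>

text \<open>The Henstock-Kurzweil gauge absorbs the exceptional null set: a tag outside
  \<open>N\<close> is controlled by differentiability, and the intervals tagged in \<open>N\<close>
  lie in an open set of measure below \<delta>, where absolute continuity makes the increments of
  \<open>F\<close> small in total.\<close>

lemma fundamental_theorem_of_calculus_abs_continuous:
  fixes F :: "real \<Rightarrow> 'a::banach"
  assumes "a \<le> b" and ac: "abs_continuous_on {a..b} F" and N: "negligible N"
    and deriv: "\<And>x. x \<in> {a..b} - N \<Longrightarrow> (F has_vector_derivative F' x) (at x within {a..b})"
  shows "(F' has_integral (F b - F a)) {a..b}"
proof (cases "a = b")
  case True
  then show ?thesis by (simp add: has_integral_refl)
next
  case False
  with \<open>a \<le> b\<close> have "a < b" by simp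
  \<comment> \<open>Tags in \<open>N\<close> then contribute only increments of \<open>F\<close> over intervals of small total length.\<close>
  define G where "G x = (if x \<in> N then 0 else F' x)" for x
  have "(G has_integral (F b - F a)) {a..b}"
    unfolding has_integral_factor_content_real
  proof safe
    fix e :: real
    assume "e > 0"
    \<comment> \<open>Half of the error budget \<open>e * (b - a)\<close>; the other half is for the
      tags outside \<open>N\<close>.\<close>
    define e' where "e' = e * (b - a) / 2"
    have "e' > 0" using \<open>e > 0\<close> \<open>a < b\<close> by (simp add: e'_def)
    with ac obtain \<delta> where "\<delta> > 0" and \<delta>: "\<forall>(n::nat) u v. (\<forall>i<n. u i \<le> v i \<and> {u i..v i} \<subseteq> {a..b}) \<longrightarrow>
        disjoint_family_on (\<lambda>i. {u i<..<v i}) {..<n} \<longrightarrow> (\<Sum>i<n. v i - u i) < \<delta> \<longrightarrow>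
        (\<Sum>i<n. dist (F (u i)) (F (v i))) < e'"
      unfolding abs_continuous_on_def by blast
    obtain U where "open U" "N \<subseteq> U" "U - N \<in> lmeasurable" "emeasure lebesgue (U - N) < ennreal \<delta>"
      using sets_lebesgue_outer_open[of N \<delta>] \<open>\<delta> > 0\<close> N
      by (metis negligible_imp_sets)
    then have U: "U \<in> lmeasurable" "measure lebesgue U < \<delta>"
    proof -
      have UN: "U = (U - N) \<union> N" using \<open>N \<subseteq> U\<close> by blast
      show "U \<in> lmeasurable"
        by (subst UN) (use N \<open>U - N \<in> lmeasurable\<close> negligible_imp_measurable in blast)
      have "measure lebesgue U = measure lebesgue (U - N)"
        using N \<open>U \<in> lmeasurable\<close> by (simp add: measure_Diff_null_set negligible_iff_null_sets)
      also have "\<dots> < \<delta>"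
        using \<open>emeasure lebesgue (U - N) < ennreal \<delta>\<close> \<open>U - N \<in> lmeasurable\<close> \<open>\<delta> > 0\<close>
        by (simp add: emeasure_eq_measure2 ennreal_less_iff)
      finally show "measure lebesgue U < \<delta>" .
    qed
    \<comment> \<open>The gauge radius at \<open>x\<close>: it stays inside \<open>U\<close> for
      tags in the null set, gives a linear approximation with relative error \<open>e/2\<close> at
      points of differentiability, and is arbitrary elsewhere.\<close>
    have "\<exists>d>0. (x \<in> N \<longrightarrow> ball x d \<subseteq> U) \<and> (x \<in> {a..b} - N \<longrightarrow>
         (\<forall>y\<in>{a..b}. norm (y-x) < d \<longrightarrow> norm (F y - F x - (y-x) *\<^sub>R F' x) \<le> e/2 * norm (y-x)))" for x
    proof (cases "x \<in> {a..b} - N")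
      case True
      then have "\<exists>d>0. \<forall>y\<in>{a..b}. norm (y-x) < d \<longrightarrow> norm (F y - F x - (y-x) *\<^sub>R F' x) \<le> e/2 * norm (y-x)"
        using deriv[OF True, unfolded has_vector_derivative_def has_derivative_within_alt] \<open>e > 0\<close>
        by (meson half_gt_zero)
      with True show ?thesis by auto
    next
      case False
      then show ?thesis using \<open>open U\<close> \<open>N \<subseteq> U\<close>
        by (metis gt_ex open_contains_ball subset_iff)
    qed
    then obtain d where d0: "\<And>x. 0 < d x"
      and dN: "\<And>x. x \<in> N \<Longrightarrow> ball x (d x) \<subseteq> U"
      and d: "\<And>x y. \<lbrakk>x \<in> {a..b} - N; y \<in> {a..b}; norm (y-x) < d x\<rbrakk>
                        \<Longrightarrow> norm (F y - F x - (y-x) *\<^sub>R F' x) \<le> e/2 * norm (y-x)"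
      by metis
    show "\<exists>d. gauge d \<and> (\<forall>p. p tagged_division_of {a..b} \<and> d fine p \<longrightarrow>
      norm ((\<Sum>(x, K)\<in>p. measure lborel K *\<^sub>R G x) - (F b - F a)) \<le> e * measure lborel {a..b})"
    proof (rule exI, safe)
      show "gauge (\<lambda>x. ball x (d x))"
        using d0 gauge_ball_dependent by blast
    next
      fix p
      assume ptag: "p tagged_division_of {a..b}" and finep: "(\<lambda>x. ball x (d x)) fine p"
      have fin: "finite p" using ptag by blast
      have K: "\<exists>u v. K = {u..v} \<and> u \<le> v \<and> u \<in> {a..b} \<and> v \<in> {a..b} \<and> x \<in> {u..v} \<and> K \<subseteq> ball x (d x)"
        if xK: "(x, K) \<in> p" for x K
      proof -
        obtain u v where uv: "K = {u..v}"
          using tagged_division_ofD(4)[OF ptag xK] by auto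
        have "x \<in> K" "K \<subseteq> {a..b}" "K \<subseteq> ball x (d x)"
          using tagged_division_ofD(2,3)[OF ptag xK] finep xK by auto
        moreover from this uv have "u \<le> v" by auto
        ultimately show ?thesis using uv by (intro exI[of _ u] exI[of _ v]) auto
      qed
      \<comment> \<open>The error of one tagged interval. The increments of \<open>F\<close>
        telescope to \<open>F b - F a\<close> over the division, so the sum of \<open>h\<close> is
        the whole error.\<close>
      define h where "h = (\<lambda>(x, K). measure lborel K *\<^sub>R G x - (F (Sup K) - F (Inf K)))"
      define B where "B = {(x, K) \<in> p. x \<in> N}"
      have B: "B \<subseteq> p" "finite B" using fin by (auto simp: B_def intro: finite_subset)
      have good: "norm (h z) \<le> e/2 * (Sup (snd z) - Inf (snd z))" if zp: "z \<in> p - B" for z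
      proof -
        obtain x K where z: "z = (x, K)" "(x, K) \<in> p" "x \<notin> N"
          using zp by (cases z) (auto simp: B_def)
        obtain u v where uv: "K = {u..v}" "u \<le> v" "u \<in> {a..b}" "v \<in> {a..b}" "x \<in> {u..v}" "K \<subseteq> ball x (d x)"
          using K[OF z(2)] by blast
        have x: "x \<in> {a..b} - N" using uv z by auto
        have "u \<in> K" "v \<in> K" using uv by auto
        with uv have "u \<in> ball x (d x)" "v \<in> ball x (d x)" by blast+
        then have *: "norm (F u - F x - (u-x) *\<^sub>R F' x) \<le> e/2 * norm (u-x)"
          "norm (F v - F x - (v-x) *\<^sub>R F' x) \<le> e/2 * norm (v-x)"
          using uv(3,4) by (intro d[OF x]; simp add: dist_real_def)+
        \<comment> \<open>Straddle estimate: as the tag \<open>x\<close> lies between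
          \<open>u\<close> and \<open>v\<close>, the approximation errors at the two ends add up to
          a multiple of \<open>v - u\<close>.\<close>
        have "h z = (F u - F x - (u-x) *\<^sub>R F' x) - (F v - F x - (v-x) *\<^sub>R F' x)"
          using uv z by (simp add: h_def G_def algebra_simps)
        then have "norm (h z) \<le> e/2 * norm (u-x) + e/2 * norm (v-x)"
          using * norm_triangle_ineq4 by (smt (verit))
        also have "\<dots> = e/2 * (v - u)"
          using uv by (simp add: field_simps)
        finally show ?thesis using uv z by simp
      qed
      have "(\<Sum>z\<in>p - B. norm (h z)) \<le> (\<Sum>z\<in>p - B. e/2 * (Sup (snd z) - Inf (snd z)))"
        by (rule sum_mono) (rule good)
      also have "\<dots> \<le> (\<Sum>z\<in>p. e/2 * (Sup (snd z) - Inf (snd z)))"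
      proof (rule sum_mono2)
        fix z assume "z \<in> p - (p - B)"
        then obtain x K where "z = (x, K)" "(x, K) \<in> p" by (cases z) auto
        with K[of x K] \<open>e > 0\<close> show "0 \<le> e/2 * (Sup (snd z) - Inf (snd z))" by auto
      qed (use fin in auto)
      also have "\<dots> = e/2 * (b - a)"
        unfolding sum_distrib_left[symmetric]
        using additive_tagged_division_1[where f = "\<lambda>x. x", OF \<open>a \<le> b\<close> ptag]
        by (simp add: case_prod_unfold)
      finally have sum1: "(\<Sum>z\<in>p - B. norm (h z)) \<le> e/2 * (b - a)" .
      \<comment> \<open>Absolute continuity is formulated for families indexed by naturals, so the
        intervals tagged in \<open>N\<close> are enumerated.\<close>
      obtain z n where z: "bij_betw z {..<n::nat} B"
        using ex_bij_betw_nat_finite[OF \<open>finite B\<close>] by (metis atLeast0LessThan)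
      have zB: "z i \<in> B" if "i < n" for i using z that by (auto simp: bij_betw_def)
      define u where "u i = Inf (snd (z i))" for i
      define v where "v i = Sup (snd (z i))" for i
      have uv: "snd (z i) = {u i..v i} \<and> u i \<le> v i \<and> {u i..v i} \<subseteq> {a..b} \<and> {u i..v i} \<subseteq> U" if i: "i < n" for i
      proof -
        obtain x K' where zi: "z i = (x, K')" "(x, K') \<in> p" "x \<in> N"
          using zB[OF i] by (auto simp: B_def)
        with K[OF zi(2)] dN[OF zi(3)] show ?thesis by (auto simp: u_def v_def)
      qed
      have disj: "disjoint_family_on (\<lambda>i. {u i<..<v i}) {..<n}"
        unfolding disjoint_family_on_def
      proof safe
        fix i j t assume ij: "i < n" "j < n" "i \<noteq> j" and t: "t \<in> {u i<..<v i}" "t \<in> {u j<..<v j}"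
        have "z i \<noteq> z j" using z ij by (auto simp: bij_betw_def inj_on_def)
        moreover have "(fst (z i), snd (z i)) \<in> p" "(fst (z j), snd (z j)) \<in> p"
          using zB ij B by auto
        ultimately have "interior (snd (z i)) \<inter> interior (snd (z j)) = {}"
          using tagged_division_ofD(5)[OF ptag] by (metis prod.collapse)
        with uv ij t show "t \<in> {}" by auto
      qed
      \<comment> \<open>Disjointness turns the total length into the measure of a union inside
        \<open>U\<close>.\<close>
      have "(\<Sum>i<n. v i - u i) = (\<Sum>i<n. measure lebesgue {u i<..<v i})"
        using uv by (intro sum.cong) auto
      also have "\<dots> = measure lebesgue (\<Union>i<n. {u i<..<v i})"
        using disj by (intro measure_finite_Union[symmetric]) (auto simp: uv)
      also have "\<dots> \<le> measure lebesgue U"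
        using uv U(1) by (intro measure_mono_fmeasurable) fastforce+
      also have "\<dots> < \<delta>" by (rule U)
      finally have small: "(\<Sum>i<n. dist (F (u i)) (F (v i))) < e'"
        using uv disj by (intro \<delta>[rule_format]) auto
      have "(\<Sum>z\<in>B. norm (h z)) = (\<Sum>i<n. norm (h (z i)))"
        by (rule sum.reindex_bij_betw[OF z, symmetric])
      also have "\<dots> = (\<Sum>i<n. dist (F (u i)) (F (v i)))"
      proof (rule sum.cong)
        fix i assume "i \<in> {..<n}"
        then have "fst (z i) \<in> N" using zB by (force simp: B_def)
        then show "norm (h (z i)) = dist (F (u i)) (F (v i))"
          by (simp add: h_def G_def case_prod_unfold u_def v_def dist_norm)
      qed simp
      finally have sum2: "(\<Sum>z\<in>B. norm (h z)) < e/2 * (b - a)"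
        using small by (simp add: e'_def)
      have "norm ((\<Sum>(x, K)\<in>p. measure lborel K *\<^sub>R G x) - (F b - F a)) = norm (\<Sum>z\<in>p. h z)"
        using additive_tagged_division_1[where f = F, OF \<open>a \<le> b\<close> ptag]
        by (simp add: h_def case_prod_unfold sum_subtractf)
      also have "\<dots> \<le> (\<Sum>z\<in>p. norm (h z))" by (rule norm_sum)
      also have "\<dots> = (\<Sum>z\<in>p - B. norm (h z)) + (\<Sum>z\<in>B. norm (h z))"
        using B fin by (simp add: sum.subset_diff)
      also have "\<dots> \<le> e * (b - a)" using sum1 sum2 by (simp add: field_simps)
      finally show "norm ((\<Sum>(x, K)\<in>p. measure lborel K *\<^sub>R G x) - (F b - F a)) \<le> e * measure lborel {a..b}"
        using \<open>a \<le> b\<close> by simp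
    qed
  qed
  then show ?thesis
    by (rule has_integral_spike[OF N, rotated]) (simp add: G_def)
qed

lemma abs_continuous_on_subset:
  "abs_continuous_on S F \<Longrightarrow> S' \<subseteq> S \<Longrightarrow> abs_continuous_on S' F"
  unfolding abs_continuous_on_def by (elim all_forward imp_forward ex_forward conj_forward) auto

lemma abs_continuous_on_diff:
  fixes F G :: "real \<Rightarrow> 'a::real_normed_vector"
  assumes "abs_continuous_on S F" "abs_continuous_on S G"
  shows "abs_continuous_on S (\<lambda>t. F t - G t)"
  unfolding abs_continuous_on_def
proof (intro allI impI)
  fix \<epsilon> :: real assume "\<epsilon> > 0"
  then have "\<epsilon> / 2 > 0" by simp
  obtain \<delta>1 where "\<delta>1 > 0" and 1: "\<forall>(n::nat) u v. (\<forall>i<n. u i \<le> v i \<and> {u i..v i} \<subseteq> S) \<longrightarrow>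
        disjoint_family_on (\<lambda>i. {u i<..<v i}) {..<n} \<longrightarrow> (\<Sum>i<n. v i - u i) < \<delta>1 \<longrightarrow>
        (\<Sum>i<n. dist (F (u i)) (F (v i))) < \<epsilon> / 2"
    using assms(1) \<open>\<epsilon> / 2 > 0\<close> unfolding abs_continuous_on_def by blast
  obtain \<delta>2 where "\<delta>2 > 0" and 2: "\<forall>(n::nat) u v. (\<forall>i<n. u i \<le> v i \<and> {u i..v i} \<subseteq> S) \<longrightarrow>
        disjoint_family_on (\<lambda>i. {u i<..<v i}) {..<n} \<longrightarrow> (\<Sum>i<n. v i - u i) < \<delta>2 \<longrightarrow>
        (\<Sum>i<n. dist (G (u i)) (G (v i))) < \<epsilon> / 2"
    using assms(2) \<open>\<epsilon> / 2 > 0\<close> unfolding abs_continuous_on_def by blast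
  show "\<exists>\<delta>>0. \<forall>(n::nat) u v. (\<forall>i<n. u i \<le> v i \<and> {u i..v i} \<subseteq> S) \<longrightarrow>
        disjoint_family_on (\<lambda>i. {u i<..<v i}) {..<n} \<longrightarrow> (\<Sum>i<n. v i - u i) < \<delta> \<longrightarrow>
        (\<Sum>i<n. dist (F (u i) - G (u i)) (F (v i) - G (v i))) < \<epsilon>"
  proof (intro exI[of _ "min \<delta>1 \<delta>2"] conjI allI impI)
    fix n :: nat and u v :: "nat \<Rightarrow> real"
    assume *: "\<forall>i<n. u i \<le> v i \<and> {u i..v i} \<subseteq> S"
      "disjoint_family_on (\<lambda>i. {u i<..<v i}) {..<n}" "(\<Sum>i<n. v i - u i) < min \<delta>1 \<delta>2"
    have "(\<Sum>i<n. dist (F (u i) - G (u i)) (F (v i) - G (v i))) \<le>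
        (\<Sum>i<n. dist (F (u i)) (F (v i)) + dist (G (u i)) (G (v i)))"
    proof (rule sum_mono)
      fix i
      have "F (u i) - G (u i) - (F (v i) - G (v i)) = (F (u i) - F (v i)) - (G (u i) - G (v i))"
        by (simp add: algebra_simps)
      then show "dist (F (u i) - G (u i)) (F (v i) - G (v i)) \<le> dist (F (u i)) (F (v i)) + dist (G (u i)) (G (v i))"
        by (simp only: dist_norm norm_triangle_ineq4)
    qed
    also have "\<dots> < \<epsilon> / 2 + \<epsilon> / 2"
      unfolding sum.distrib using 1 2 * by (intro add_strict_mono) auto
    finally show "(\<Sum>i<n. dist (F (u i) - G (u i)) (F (v i) - G (v i))) < \<epsilon>" by simp
  qed (use \<open>\<delta>1 > 0\<close> \<open>\<delta>2 > 0\<close> in auto)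
qed

lemma abs_continuous_on_imp_continuous_on:
  assumes "abs_continuous_on {a..b} F"
  shows "continuous_on {a..b} F"
  unfolding continuous_on_iff
proof (intro ballI allI impI)
  fix x and \<epsilon> :: real assume x: "x \<in> {a..b}" and "\<epsilon> > 0"
  then obtain \<delta> where "\<delta> > 0" and \<delta>: "\<forall>(n::nat) u v. (\<forall>i<n. u i \<le> v i \<and> {u i..v i} \<subseteq> {a..b}) \<longrightarrow>
        disjoint_family_on (\<lambda>i. {u i<..<v i}) {..<n} \<longrightarrow> (\<Sum>i<n. v i - u i) < \<delta> \<longrightarrow>
        (\<Sum>i<n. dist (F (u i)) (F (v i))) < \<epsilon>"
    using assms unfolding abs_continuous_on_def by blast
  have *: "dist (F s) (F t) < \<epsilon>" if "s \<in> {a..b}" "t \<in> {a..b}" "s \<le> t" "t - s < \<delta>" for s t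
    using \<delta>[rule_format, of 1 "\<lambda>_. s" "\<lambda>_. t"] that by (auto simp: disjoint_family_on_def)
  show "\<exists>\<delta>>0. \<forall>t\<in>{a..b}. dist t x < \<delta> \<longrightarrow> dist (F t) (F x) < \<epsilon>"
  proof (intro exI[of _ \<delta>] conjI ballI impI)
    fix t assume "t \<in> {a..b}" "dist t x < \<delta>"
    then show "dist (F t) (F x) < \<epsilon>"
      using *[of t x] *[of x t] x by (cases "t \<le> x") (auto simp: dist_real_def dist_commute)
  qed (rule \<open>\<delta> > 0\<close>)
qed

text \<open>Integrating the almost everywhere derivative over \<open>{a..s}\<close> represents
  \<open>F\<close> as a primitive of the continuous \<open>G\<close>, which is differentiable at
  every point. This upgrades Caratheodory solutions with continuous right-hand sides to classical
  ones.\<close>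

lemma abs_continuous_on_AE_derivative:
  fixes F :: "real \<Rightarrow> 'a::banach"
  assumes ac: "abs_continuous_on {a..b} F" and cont: "continuous_on {a..b} G"
    and ae: "AE t in lebesgue. t \<in> {a<..<b} \<longrightarrow> (F has_vector_derivative G t) (at t)"
    and t: "t \<in> {a..b}"
  shows "(F has_vector_derivative G t) (at t within {a..b})"
proof -
  \<comment> \<open>The end points are added because the hypothesis speaks of the open interval
    only.\<close>
  define N where "N = {t. \<not> (t \<in> {a<..<b} \<longrightarrow> (F has_vector_derivative G t) (at t))} \<union> {a, b}"
  have "{t. \<not> (t \<in> {a<..<b} \<longrightarrow> (F has_vector_derivative G t) (at t))} \<in> null_sets lebesgue"
    using ae by (subst (asm) completion.AE_iff_null_sets) simp
  then have N: "negligible N"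
    unfolding N_def by (intro negligible_Un) (auto simp: negligible_iff_null_sets[symmetric])
  have "F s = F a + integral {a..s} G" if s: "s \<in> {a..b}" for s
  proof -
    have "(G has_integral (F s - F a)) {a..s}"
    proof (rule fundamental_theorem_of_calculus_abs_continuous)
      show "abs_continuous_on {a..s} F" using ac s by (auto intro: abs_continuous_on_subset)
      show "(F has_vector_derivative G x) (at x within {a..s})" if "x \<in> {a..s} - N" for x
      proof -
        have "x \<in> {a<..<b}" using that s by (auto simp: N_def)
        with that show ?thesis by (auto simp: N_def intro: has_vector_derivative_at_within)
      qed
    qed (use s N in auto)
    then show ?thesis by (simp add: integral_unique)
  qed
  moreover have "((\<lambda>s. F a + integral {a..s} G) has_vector_derivative G t) (at t within {a..b})"
    using integral_has_vector_derivative[OF cont t] by (auto intro!: derivative_eq_intros)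
  ultimately show ?thesis
    using t by (intro has_vector_derivative_transform[of t "{a..b}" F "\<lambda>s. F a + integral {a..s} G"])
qed

section \<open>The homogeneous system\<close>

definition homogeneous_solution ::
  "real ^ 'n ^ 'n \<Rightarrow> real \<Rightarrow> real \<Rightarrow> real \<Rightarrow> (real \<Rightarrow> real ^ 'n) \<Rightarrow> (real \<Rightarrow> real ^ 'n) \<Rightarrow> bool" where
  "homogeneous_solution L \<gamma> a b e q \<longleftrightarrow> (\<forall>t\<in>{a..b}.
     (e has_vector_derivative L *v e t - q t /\<^sub>R \<gamma>) (at t within {a..b}) \<and>
     (q has_vector_derivative - (L *v q t) - e t) (at t within {a..b}))"

lemma homogeneous_solution_subset:
  "homogeneous_solution L \<gamma> a b e q \<Longrightarrow> a \<le> s \<Longrightarrow> t \<le> b \<Longrightarrow> homogeneous_solution L \<gamma> s t e q"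
  unfolding homogeneous_solution_def
proof (intro ballI)
  fix r
  assume sol: "\<forall>t\<in>{a..b}. (e has_vector_derivative L *v e t - q t /\<^sub>R \<gamma>) (at t within {a..b}) \<and>
     (q has_vector_derivative - (L *v q t) - e t) (at t within {a..b})"
    and "a \<le> s" "t \<le> b" "r \<in> {s..t}"
  then have "r \<in> {a..b}" "{s..t} \<subseteq> {a..b}" by auto
  with sol show "(e has_vector_derivative L *v e r - q r /\<^sub>R \<gamma>) (at r within {s..t}) \<and>
     (q has_vector_derivative - (L *v q r) - e r) (at r within {s..t})"
    by (blast intro: has_vector_derivative_within_subset)
qed

lemma has_real_derivative_inner_self:
  fixes x :: "real \<Rightarrow> 'a::real_inner"
  assumes "(x has_vector_derivative x') (at t within S)"
  shows "((\<lambda>t. x t \<bullet> x t) has_real_derivative 2 * (x t \<bullet> x')) (at t within S)"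
  using bounded_bilinear.has_vector_derivative[OF bounded_bilinear_inner assms assms]
  by (simp add: has_real_derivative_iff_has_vector_derivative inner_commute)

lemma inner_abs_le_sum_squares:
  fixes x y :: "'a::real_inner"
  shows "2 * \<bar>x \<bullet> y\<bar> \<le> x \<bullet> x + y \<bullet> y"
proof -
  have "0 \<le> (x + y) \<bullet> (x + y)" "0 \<le> (x - y) \<bullet> (x - y)" by simp_all
  then show ?thesis by (simp add: inner_add inner_diff inner_commute abs_if)
qed

text \<open>
  For \<open>c = 0\<close> the coupling terms cancel; a small \<open>c > 0\<close> is absorbed by the coercivity of \<open>- L\<close>
  and makes the estimate on the first time interval a strict contraction.
\<close>

lemma weighted_energy_decreasing:
  fixes L :: "real ^ 'n::finite ^ 'n"
  assumes sol: "homogeneous_solution L \<gamma> a b e q" and "a \<le> b" "\<gamma> > 0"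
    and coercive: "\<And>x. x \<bullet> (L *v x) \<le> - \<mu> * (x \<bullet> x)" and "\<mu> > 0"
    and c: "0 \<le> c" "c \<le> 1 / 2" "c \<le> \<mu> * \<gamma>" "c \<le> \<mu> / 2"
  shows "(1 + c) * (e b \<bullet> e b) - (1 - c) * (q b \<bullet> q b) / \<gamma> \<le> (1 + c) * (e a \<bullet> e a) - (1 - c) * (q a \<bullet> q a) / \<gamma>"
proof -
  define Z where "Z t = (1 + c) * (e t \<bullet> e t) - (1 - c) * (q t \<bullet> q t) / \<gamma>" for t
  \<comment> \<open>The left-hand side is the derivative of \<open>Z\<close> with \<open>x\<close>,
    \<open>y\<close> in place of \<open>e t\<close>, \<open>q t\<close>. The cross term is split
    between the two squares: \<open>c \<le> \<mu> * \<gamma>\<close> lets the first dissipation term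
    absorb the \<open>x\<close> part, and \<open>c \<le> \<mu> / 2\<close> together with
    \<open>1 - c \<ge> 1 / 2\<close> lets the second absorb the \<open>y\<close> part.\<close>
  have le: "2 * (1 + c) * (x \<bullet> (L *v x)) + 2 * (1 - c) * (y \<bullet> (L *v y)) / \<gamma> - 4 * c * (x \<bullet> y) / \<gamma> \<le> 0" for x y
  proof -
    have "(1 + c) * (x \<bullet> (L *v x)) \<le> (1 + c) * (- \<mu> * (x \<bullet> x))"
      using coercive c by (intro mult_left_mono) auto
    also have "\<dots> \<le> - \<mu> * (x \<bullet> x)"
      using c \<open>\<mu> > 0\<close> by (simp add: algebra_simps)
    also have "\<dots> \<le> - c * (x \<bullet> x) / \<gamma>"
      using mult_right_mono[OF c(3), of "x \<bullet> x"] \<open>\<gamma> > 0\<close> by (simp add: field_simps)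
    finally have 1: "(1 + c) * (x \<bullet> (L *v x)) \<le> - c * (x \<bullet> x) / \<gamma>" .
    have "(1 - c) * (y \<bullet> (L *v y)) \<le> (1 - c) * (- \<mu> * (y \<bullet> y))"
      using coercive c by (intro mult_left_mono) auto
    also have "\<dots> = - ((1 - c) * \<mu>) * (y \<bullet> y)" by simp
    also have "\<dots> \<le> - c * (y \<bullet> y)"
    proof (rule mult_right_mono)
      have "1 / 2 * \<mu> \<le> (1 - c) * \<mu>" using c \<open>\<mu> > 0\<close> by (intro mult_right_mono) auto
      then show "- ((1 - c) * \<mu>) \<le> - c" using c by simp
    qed simp
    finally have 2: "(1 - c) * (y \<bullet> (L *v y)) / \<gamma> \<le> - c * (y \<bullet> y) / \<gamma>"
      using \<open>\<gamma> > 0\<close> by (rule divide_right_mono[OF _ less_imp_le])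
    have "- (2 * (x \<bullet> y)) \<le> x \<bullet> x + y \<bullet> y"
      using inner_abs_le_sum_squares[of x y] by linarith
    then have "c * - (2 * (x \<bullet> y)) / \<gamma> \<le> c * (x \<bullet> x + y \<bullet> y) / \<gamma>"
      using \<open>\<gamma> > 0\<close> c by (intro divide_right_mono mult_left_mono) auto
    also have "\<dots> = c * (x \<bullet> x) / \<gamma> + c * (y \<bullet> y) / \<gamma>"
      by (simp add: distrib_left add_divide_distrib)
    finally have 3: "c * - (2 * (x \<bullet> y)) / \<gamma> \<le> c * (x \<bullet> x) / \<gamma> + c * (y \<bullet> y) / \<gamma>" .
    have "2 * (1 + c) * (x \<bullet> (L *v x)) + 2 * (1 - c) * (y \<bullet> (L *v y)) / \<gamma> - 4 * c * (x \<bullet> y) / \<gamma> =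
        2 * ((1 + c) * (x \<bullet> (L *v x)) + (1 - c) * (y \<bullet> (L *v y)) / \<gamma> + c * - (2 * (x \<bullet> y)) / \<gamma>)"
      by (simp add: divide_inverse algebra_simps)
    with 1 2 3 show ?thesis by simp
  qed
  \<comment> \<open>The couplings \<open>- 2 * (1 + c)\<close> from \<open>e\<close> and
    \<open>2 * (1 - c)\<close> from \<open>q\<close> leave \<open>- 4 * c\<close>.\<close>
  have dZ: "(Z has_real_derivative 2 * (1 + c) * (e t \<bullet> (L *v e t)) + 2 * (1 - c) * (q t \<bullet> (L *v q t)) / \<gamma>
      - 4 * c * (e t \<bullet> q t) / \<gamma>) (at t within {a..b})" if "t \<in> {a..b}" for t
  proof -
    have "(e has_vector_derivative L *v e t - q t /\<^sub>R \<gamma>) (at t within {a..b})"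
      "(q has_vector_derivative - (L *v q t) - e t) (at t within {a..b})"
      using sol that by (auto simp: homogeneous_solution_def)
    note d = this[THEN has_real_derivative_inner_self]
    show ?thesis
      unfolding Z_def[abs_def]
      by (rule DERIV_cong[OF DERIV_diff[OF DERIV_cmult[OF d(1)] DERIV_cdivide[OF DERIV_cmult[OF d(2)]]]])
        (simp add: divide_inverse inner_diff_right inner_commute[of "q t" "e t"] algebra_simps)
  qed
  have "Z b \<le> Z a"
  proof (rule DERIV_nonpos_imp_decreasing_open[OF \<open>a \<le> b\<close>])
    show "\<exists>y. DERIV Z t :> y \<and> y \<le> 0" if "a < t" "t < b" for t
      using dZ[of t] le that by (auto simp: at_within_Icc_at)
    show "continuous_on {a..b} Z"
      using dZ by (meson DERIV_continuous continuous_on_eq_continuous_within)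
  qed
  then show ?thesis by (simp add: Z_def)
qed

text \<open>The bound on the derivative makes \<open>exp (K * t) * V t\<close> nondecreasing and
  \<open>exp (- K * t) * V t\<close> nonincreasing. Both directions in time are wanted because
  \<open>T\<^sub>1\<close> is the right end of one subdomain and the left end of the other.\<close>

lemma gronwall_two_sided:
  fixes V :: "real \<Rightarrow> real"
  assumes "a \<le> b" and dV: "\<And>t. t \<in> {a..b} \<Longrightarrow> (V has_real_derivative V' t) (at t within {a..b})"
    and le: "\<And>t. t \<in> {a..b} \<Longrightarrow> \<bar>V' t\<bar> \<le> K * V t"
  shows "V b \<le> exp (K * (b - a)) * V a" and "V a \<le> exp (K * (b - a)) * V b"
proof -
  \<comment> \<open>The choices \<open>s = 1\<close> and \<open>s = -1\<close> give the two
    exponential weights.\<close>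
  have d: "((\<lambda>t. exp (s * K * t) * V t) has_real_derivative exp (s * K * t) * (s * K * V t + V' t))
      (at t within {a..b})" if "t \<in> {a..b}" for s t
    by (rule derivative_eq_intros dV[OF that] refl)+ (simp add: algebra_simps)
  then have cont: "continuous_on {a..b} (\<lambda>t. exp (s * K * t) * V t)" for s
    by (meson DERIV_continuous continuous_on_eq_continuous_within)
  have "exp (1 * K * a) * V a \<le> exp (1 * K * b) * V b"
  proof (rule DERIV_nonneg_imp_increasing_open[OF \<open>a \<le> b\<close> _ cont])
    show "\<exists>y. DERIV (\<lambda>t. exp (1 * K * t) * V t) t :> y \<and> y \<ge> 0" if "a < t" "t < b" for t
      using d[of t 1] le[of t] that
      by (intro exI[of _ "exp (1 * K * t) * (1 * K * V t + V' t)"]) (auto simp: at_within_Icc_at)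
  qed
  then show "V a \<le> exp (K * (b - a)) * V b"
    by (simp add: right_diff_distrib exp_diff field_simps)
  have "exp (-1 * K * a) * V a \<ge> exp (-1 * K * b) * V b"
  proof (rule DERIV_nonpos_imp_decreasing_open[OF \<open>a \<le> b\<close> _ cont])
    show "\<exists>y. DERIV (\<lambda>t. exp (-1 * K * t) * V t) t :> y \<and> y \<le> 0" if "a < t" "t < b" for t
      using d[of t "-1"] le[of t] that
      by (intro exI[of _ "exp (-1 * K * t) * (-1 * K * V t + V' t)"])
        (auto simp: at_within_Icc_at mult_le_0_iff)
  qed
  then show "V b \<le> exp (K * (b - a)) * V a"
    by (simp add: right_diff_distrib exp_diff exp_minus field_simps)
qed

text \<open>\<open>L\<close> acts with opposite signs on \<open>e\<close> and \<open>q\<close>, so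
  it is estimated through its operator norm, which serves both directions in time. \<open>K\<close>
  depends on \<open>L\<close> and \<gamma> only and hence is common to all iterates.\<close>

lemma homogeneous_solution_growth:
  fixes L :: "real ^ 'n::finite ^ 'n"
  assumes "\<gamma> > 0"
  obtains K where "\<And>a b e q. homogeneous_solution L \<gamma> a b e q \<Longrightarrow> a \<le> b \<Longrightarrow>
      e b \<bullet> e b + q b \<bullet> q b \<le> exp (K * (b - a)) * (e a \<bullet> e a + q a \<bullet> q a) \<and>
      e a \<bullet> e a + q a \<bullet> q a \<le> exp (K * (b - a)) * (e b \<bullet> e b + q b \<bullet> q b)"
proof -
  define B where "B = onorm ((*v) L)"
  have bl: "bounded_linear ((*v) L)" by simp
  have B: "\<bar>x \<bullet> (L *v x)\<bar> \<le> B * (x \<bullet> x)" for x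
  proof -
    have "\<bar>x \<bullet> (L *v x)\<bar> \<le> norm x * norm (L *v x)" by (rule Cauchy_Schwarz_ineq2)
    also have "\<dots> \<le> norm x * (B * norm x)"
      unfolding B_def by (intro mult_left_mono onorm[OF bl]) auto
    finally show ?thesis by (simp add: dot_square_norm power2_eq_square mult_ac)
  qed
  define K where "K = 2 * B + (1 / \<gamma> + 1)"
  have "e b \<bullet> e b + q b \<bullet> q b \<le> exp (K * (b - a)) * (e a \<bullet> e a + q a \<bullet> q a) \<and>
      e a \<bullet> e a + q a \<bullet> q a \<le> exp (K * (b - a)) * (e b \<bullet> e b + q b \<bullet> q b)"
    if sol: "homogeneous_solution L \<gamma> a b e q" and "a \<le> b" for a b e q
  proof -
    define V' where "V' t = 2 * (e t \<bullet> (L *v e t)) - 2 * (q t \<bullet> (L *v q t)) - 2 * (1 / \<gamma> + 1) * (e t \<bullet> q t)" for t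
    have dV: "((\<lambda>t. e t \<bullet> e t + q t \<bullet> q t) has_real_derivative V' t) (at t within {a..b})" if "t \<in> {a..b}" for t
    proof -
      have "(e has_vector_derivative L *v e t - q t /\<^sub>R \<gamma>) (at t within {a..b})"
        "(q has_vector_derivative - (L *v q t) - e t) (at t within {a..b})"
        using sol that by (auto simp: homogeneous_solution_def)
      note d = this[THEN has_real_derivative_inner_self]
      show ?thesis
        by (rule derivative_eq_intros d refl)+
          (simp add: V'_def inner_diff_right inner_commute[of "q t" "e t"] divide_inverse algebra_simps)
    qed
    have le: "\<bar>V' t\<bar> \<le> K * (e t \<bullet> e t + q t \<bullet> q t)" for t
    proof -
      have "\<bar>V' t\<bar> \<le> 2 * \<bar>e t \<bullet> (L *v e t)\<bar> + 2 * \<bar>q t \<bullet> (L *v q t)\<bar> + (1 / \<gamma> + 1) * (2 * \<bar>e t \<bullet> q t\<bar>)"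
      proof -
        have "\<bar>2 * (1 / \<gamma> + 1) * (e t \<bullet> q t)\<bar> = (1 / \<gamma> + 1) * (2 * \<bar>e t \<bullet> q t\<bar>)"
          using \<open>\<gamma> > 0\<close> by (simp add: abs_mult)
        then show ?thesis unfolding V'_def by linarith
      qed
      also have "\<dots> \<le> 2 * (B * (e t \<bullet> e t)) + 2 * (B * (q t \<bullet> q t)) + (1 / \<gamma> + 1) * (e t \<bullet> e t + q t \<bullet> q t)"
        using B \<open>\<gamma> > 0\<close> inner_abs_le_sum_squares by (intro add_mono mult_left_mono) auto
      finally show ?thesis by (simp add: K_def algebra_simps)
    qed
    show ?thesis using gronwall_two_sided[OF \<open>a \<le> b\<close> dV le] by simp
  qed
  then show thesis using that by blast
qed

text \<open>The data \<open>f\<close> and \<open>g\<close> cancel in the difference. What remains on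
  the right-hand sides is continuous, so the almost everywhere equations hold everywhere. The larger
  interval is that of the global solution, compared with an iterate on a subdomain.\<close>

lemma optimality_solution_diff:
  fixes L :: "real ^ 'n::finite ^ 'n"
  assumes z: "optimality_solution L \<gamma> f g a' b' y p" and "{a..b} \<subseteq> {a'..b'}" and "a < b"
    and w: "optimality_solution L \<gamma> f g a b v r"
  shows "homogeneous_solution L \<gamma> a b (\<lambda>t. v t - y t) (\<lambda>t. r t - p t)"
proof -
  define e q where "e t = v t - y t" and "q t = r t - p t" for t
  have "{a<..<b} \<subseteq> {a'<..<b'}" using \<open>{a..b} \<subseteq> {a'..b'}\<close> \<open>a < b\<close> by auto
  have e: "abs_continuous_on {a..b} e" and q: "abs_continuous_on {a..b} q"
    using z w \<open>{a..b} \<subseteq> {a'..b'}\<close> unfolding optimality_solution_def e_def q_def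
    by (blast intro: abs_continuous_on_diff abs_continuous_on_subset)+
  note [continuous_intros] = abs_continuous_on_imp_continuous_on[OF e]
    abs_continuous_on_imp_continuous_on[OF q]
    linear_continuous_on_compose[OF _ matrix_vector_mul_linear]
  have ae: "AE t in lebesgue. t \<in> {a<..<b} \<longrightarrow>
      (e has_vector_derivative L *v e t - q t /\<^sub>R \<gamma>) (at t) \<and>
      (q has_vector_derivative - (L *v q t) - e t) (at t)"
    using z w unfolding optimality_solution_def
  proof (elim conjE, elim AE_mp, intro AE_I2 impI)
    fix t
    assume "t \<in> {a'<..<b'} \<longrightarrow> (\<exists>y' p'. (y has_vector_derivative y') (at t) \<and>
          (p has_vector_derivative p') (at t) \<and> - y' + L *v y t - p t /\<^sub>R \<gamma> = f t \<and> p' + L *v p t + y t = g t)"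
      and "t \<in> {a<..<b} \<longrightarrow> (\<exists>y' p'. (v has_vector_derivative y') (at t) \<and>
          (r has_vector_derivative p') (at t) \<and> - y' + L *v v t - r t /\<^sub>R \<gamma> = f t \<and> p' + L *v r t + v t = g t)"
      and "t \<in> {a<..<b}"
    moreover from this have "t \<in> {a'<..<b'}" using \<open>{a<..<b} \<subseteq> {a'<..<b'}\<close> by blast
    ultimately obtain y' p' v' r' where
      d: "(y has_vector_derivative y') (at t)" "(p has_vector_derivative p') (at t)"
        "(v has_vector_derivative v') (at t)" "(r has_vector_derivative r') (at t)"
      and eq: "- y' + L *v y t - p t /\<^sub>R \<gamma> = f t" "p' + L *v p t + y t = g t"
        "- v' + L *v v t - r t /\<^sub>R \<gamma> = f t" "r' + L *v r t + v t = g t"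
      by auto
    have "v' - y' = L *v e t - q t /\<^sub>R \<gamma>"
      using eq(1,3) by (simp add: e_def q_def matrix_vector_mult_diff_distrib scaleR_diff_right algebra_simps)
    moreover have "r' - p' = - (L *v q t) - e t"
      using eq(2,4) by (simp add: e_def q_def matrix_vector_mult_diff_distrib algebra_simps)
    ultimately show "(e has_vector_derivative L *v e t - q t /\<^sub>R \<gamma>) (at t) \<and>
      (q has_vector_derivative - (L *v q t) - e t) (at t)"
      using has_vector_derivative_diff[OF d(3,1)] has_vector_derivative_diff[OF d(4,2)]
      by (simp add: e_def[abs_def] q_def[abs_def])
  qed
  have "(e has_vector_derivative L *v e t - q t /\<^sub>R \<gamma>) (at t within {a..b})" if "t \<in> {a..b}" for t
    using ae by (intro abs_continuous_on_AE_derivative[OF e _ _ that, where G = "\<lambda>t. L *v e t - q t /\<^sub>R \<gamma>"])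
      (auto intro!: continuous_intros)
  moreover have "(q has_vector_derivative - (L *v q t) - e t) (at t within {a..b})" if "t \<in> {a..b}" for t
    using ae by (intro abs_continuous_on_AE_derivative[OF q _ _ that, where G = "\<lambda>t. - (L *v q t) - e t"])
      (auto intro!: continuous_intros)
  ultimately show ?thesis
    unfolding homogeneous_solution_def e_def q_def by blast
qed

section \<open>Negative definiteness of the discrete Laplacian\<close>

text \<open>
  A positive supersolution for the discrete Dirichlet problem, with \<open>\<Delta>\<^sub>h w = - 2 / h\<^sup>2\<close> and
  \<open>w \<le> 1 / h\<^sup>2\<close>. Scaling the arithmetic-geometric mean inequality for \<open>Z\<^sub>i Z\<^sub>j\<close> by the ratio
  \<open>w\<^sub>j / w\<^sub>i\<close> turns it into a lower bound for the spectrum of \<open>- \<Delta>\<^sub>h\<close>.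
\<close>

definition grid_weight :: "nat \<Rightarrow> nat list \<Rightarrow> real" where
  "grid_weight M i = real (i ! 0) * (real M - real (i ! 0))"

lemma finite_grid_neighbours [simp]: "finite (grid_neighbours i)"
  by (simp add: grid_neighbours_def)

lemma interior_grid_nth:
  assumes "i \<in> interior_grid d M" "k < d"
  shows "0 < i ! k" "i ! k < M"
  using assms nth_mem[of k i] by (force simp: interior_grid_def)+

lemma grid_weight_pos:
  assumes "i \<in> interior_grid d M" "d \<ge> 1"
  shows "0 < grid_weight M i"
  using interior_grid_nth[OF assms(1), of 0] assms(2) by (simp add: grid_weight_def)

lemma grid_weight_le:
  assumes "i \<in> interior_grid d M" "d \<ge> 1"
  shows "grid_weight M i \<le> (real M)\<^sup>2"
  using interior_grid_nth[OF assms(1), of 0] assms(2)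
  by (auto simp: grid_weight_def power2_eq_square intro!: mult_mono)

text \<open>A unit step from an interior point keeps the first index in \<open>{0..M}\<close>, where
  the parabola is nonnegative. This permits boundary neighbours to be added back in the coercivity
  estimate.\<close>

lemma grid_weight_neighbour_nonneg:
  assumes "i \<in> interior_grid d M" "d \<ge> 1" "j \<in> grid_neighbours i"
  shows "0 \<le> grid_weight M j"
proof -
  have i0: "0 < i ! 0" "i ! 0 < M" using interior_grid_nth[OF assms(1), of 0] assms(2) by auto
  obtain k where "k < length i" "j = i[k := i ! k + 1] \<or> j = i[k := i ! k - 1]"
    using assms(3) by (auto simp: grid_neighbours_def)
  then have "j ! 0 \<le> M"
    using i0 by (cases "k = 0") auto
  then show ?thesis by (simp add: grid_weight_def)
qed

text \<open>The weight depends on the first index only, so only the two neighbours in that direction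
  contribute, and they give the second difference of the parabola
  \<open>n * (M - n)\<close>.\<close>

lemma sum_grid_weight_neighbours:
  assumes "i \<in> interior_grid d M" "d \<ge> 1"
  shows "(\<Sum>j\<in>grid_neighbours i. grid_weight M j - grid_weight M i) = - 2"
proof -
  have i0: "0 < i ! 0" "i ! 0 < M" using interior_grid_nth[OF assms(1), of 0] assms(2) by auto
  have len: "0 < length i" using assms by (auto simp: interior_grid_def)
  let ?p = "i[0 := i ! 0 + 1]" and ?m = "i[0 := i ! 0 - 1]"
  \<comment> \<open>The neighbours form a set, so the two must be distinct to be counted
    separately.\<close>
  have "?p ! 0 \<noteq> ?m ! 0" using len by simp
  then have ne: "?p \<noteq> ?m" by metis
  have "(\<Sum>j\<in>grid_neighbours i. grid_weight M j - grid_weight M i) =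
      (\<Sum>j\<in>{?p, ?m}. grid_weight M j - grid_weight M i)"
  proof (rule sum.mono_neutral_right)
    show "{?p, ?m} \<subseteq> grid_neighbours i" using len unfolding grid_neighbours_def by blast
    show "\<forall>j\<in>grid_neighbours i - {?p, ?m}. grid_weight M j - grid_weight M i = 0"
    proof
      fix j assume j: "j \<in> grid_neighbours i - {?p, ?m}"
      then obtain k where k: "j = i[k := i ! k + 1] \<or> j = i[k := i ! k - 1]"
        by (auto simp: grid_neighbours_def)
      with j have "k \<noteq> 0" by (intro notI) auto
      with k have "j ! 0 = i ! 0" by auto
      then show "grid_weight M j - grid_weight M i = 0" by (simp add: grid_weight_def)
    qed
  qed simp
  also have "\<dots> = (grid_weight M ?p - grid_weight M i) + (grid_weight M ?m - grid_weight M i)"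
    using ne by simp
  also have "\<dots> = - 2"
    using i0 len by (simp add: grid_weight_def of_nat_diff algebra_simps)
  finally show ?thesis .
qed

text \<open>At an interior point \<open>i ! k\<close> is positive, so the truncated
  \<open>i ! k - 1\<close> is undone by adding one.\<close>

lemma grid_neighbours_sym:
  assumes "i \<in> interior_grid d M" "j \<in> grid_neighbours i"
  shows "i \<in> grid_neighbours j"
proof -
  obtain k where k: "k < length i" "j = i[k := i ! k + 1] \<or> j = i[k := i ! k - 1]"
    using assms(2) by (auto simp: grid_neighbours_def)
  have "0 < i ! k" using assms(1) k(1) interior_grid_nth(1)[OF assms(1)] by (simp add: interior_grid_def)
  with k have "i = j[k := j ! k - 1] \<or> i = j[k := j ! k + 1]" "k < length j" by auto
  then show ?thesis unfolding grid_neighbours_def by blast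
qed

text \<open>With \<open>N\<close> the neighbours of a point, this moves stencil sums with zero
  boundary values to sums over the numbering, where double sums can be exchanged.\<close>

lemma sum_over_range:
  fixes \<nu> :: "'n::finite \<Rightarrow> 'b" and \<phi> :: "'b \<Rightarrow> real"
  assumes "inj \<nu>" "finite N"
  shows "(\<Sum>j\<in>N. if j \<in> range \<nu> then \<phi> j else 0) = (\<Sum>s\<in>UNIV. if \<nu> s \<in> N then \<phi> (\<nu> s) else 0)"
proof -
  have "(\<Sum>j\<in>N. if j \<in> range \<nu> then \<phi> j else 0) = (\<Sum>j\<in>N \<inter> range \<nu>. \<phi> j)"
    using \<open>finite N\<close> by (simp add: sum.inter_restrict)
  also have "N \<inter> range \<nu> = \<nu> ` {s. \<nu> s \<in> N}" by auto
  also have "(\<Sum>j\<in>\<nu> ` {s. \<nu> s \<in> N}. \<phi> j) = (\<Sum>s\<in>{s. \<nu> s \<in> N}. \<phi> (\<nu> s))"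
    using \<open>inj \<nu>\<close> by (subst sum.reindex) (auto simp: inj_on_def)
  also have "\<dots> = (\<Sum>s\<in>UNIV. if \<nu> s \<in> N then \<phi> (\<nu> s) else 0)"
    by (simp add: sum.inter_filter[symmetric])
  finally show ?thesis .
qed

text \<open>A discrete form of Barta's inequality: the quotient of
  \<open>- \<Delta>\<^sub>h w\<close> by \<open>w\<close> is \<open>2 * M^2 / w\<close>, which is at
  least 2 because \<open>w \<le> M^2\<close>. The constant is thus independent of mesh and
  dimension.\<close>

lemma discrete_laplacian_coercive:
  fixes \<nu> :: "'n::finite \<Rightarrow> nat list" and Z :: "real ^ 'n"
  assumes bij: "bij_betw \<nu> UNIV (interior_grid d M)" and "d \<ge> 1"
  shows "Z \<bullet> (discrete_laplacian M \<nu> *v Z) \<le> - 2 * (Z \<bullet> Z)"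
proof -
  let ?N = "\<lambda>r. grid_neighbours (\<nu> r)" and ?w = "\<lambda>r. grid_weight M (\<nu> r)"
  have inj: "inj \<nu>" using bij by (simp add: bij_betw_def)
  have int: "\<nu> r \<in> interior_grid d M" for r using bij by (auto simp: bij_betw_def)
  have w: "0 < ?w r" "?w r \<le> (real M)\<^sup>2" for r
    using grid_weight_pos[OF int \<open>d \<ge> 1\<close>] grid_weight_le[OF int \<open>d \<ge> 1\<close>] by auto
  have gv: "(\<Sum>j\<in>?N r. grid_value \<nu> Z j) = (\<Sum>s\<in>UNIV. if \<nu> s \<in> ?N r then Z $ s else 0)" for r
    using sum_over_range[OF inj, of "?N r" "\<lambda>j. Z $ inv \<nu> j"] inj
    by (simp add: grid_value_def cong: if_cong)
  have sym: "\<nu> s \<in> ?N r \<longleftrightarrow> \<nu> r \<in> ?N s" for r s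
    using grid_neighbours_sym[OF int] by blast
  \<comment> \<open>To be used with \<open>x\<close>, \<open>y\<close> the values of
    \<open>Z\<close> and \<open>u\<close>, \<open>v\<close> the weights at two neighbours; it
    expresses that \<open>(v * x - u * y)^2\<close> is nonnegative.\<close>
  have amgm: "x * y \<le> (v / u * x\<^sup>2 + u / v * y\<^sup>2) / 2" if "0 < u" "0 < v" for x y u v :: real
  proof -
    have "0 \<le> (v * x - u * y)\<^sup>2 / (2 * u * v)" using that by simp
    also have "\<dots> = (v / u * x\<^sup>2 + u / v * y\<^sup>2) / 2 - x * y"
      using that by (simp add: field_simps power2_eq_square)
    finally show ?thesis by simp
  qed
  define a where "a r s = (if \<nu> s \<in> ?N r then ?w s / ?w r * (Z $ r)\<^sup>2 else 0)" for r s
  have "(\<Sum>r\<in>UNIV. Z $ r * (\<Sum>j\<in>?N r. grid_value \<nu> Z j)) =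
      (\<Sum>r\<in>UNIV. \<Sum>s\<in>UNIV. if \<nu> s \<in> ?N r then Z $ r * Z $ s else 0)"
    by (simp add: gv sum_distrib_left if_distrib cong: if_cong)
  \<comment> \<open>Symmetry of the neighbour relation makes the conditions in \<open>a r s\<close>
    and \<open>a s r\<close> agree; exchanging the sums then merges the two halves.\<close>
  also have "\<dots> \<le> (\<Sum>r\<in>UNIV. \<Sum>s\<in>UNIV. (a r s + a s r) / 2)"
    using amgm w by (intro sum_mono) (auto simp: a_def sym)
  also have "\<dots> = (\<Sum>r\<in>UNIV. \<Sum>s\<in>UNIV. a r s)"
    using sum.swap[of a UNIV UNIV] 
    by (simp add: sum_divide_distrib[symmetric] sum.distrib)
  also have "\<dots> = (\<Sum>r\<in>UNIV. (Z $ r)\<^sup>2 / ?w r * (\<Sum>s\<in>UNIV. if \<nu> s \<in> ?N r then ?w s else 0))"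
    by (simp add: a_def sum_distrib_left if_distrib mult.commute cong: if_cong)
  \<comment> \<open>Boundary neighbours are missing from the sum over the numbering; adding their
    nonnegative weights completes the stencil applied to the weight.\<close>
  also have "\<dots> \<le> (\<Sum>r\<in>UNIV. (Z $ r)\<^sup>2 / ?w r * (\<Sum>j\<in>?N r. grid_weight M j))"
  proof (intro sum_mono mult_left_mono)
    fix r
    have "(\<Sum>j\<in>?N r. if j \<in> range \<nu> then grid_weight M j else 0) \<le> (\<Sum>j\<in>?N r. grid_weight M j)"
      using grid_weight_neighbour_nonneg[OF int \<open>d \<ge> 1\<close>] by (intro sum_mono) auto
    then show "(\<Sum>s\<in>UNIV. if \<nu> s \<in> ?N r then ?w s else 0) \<le> (\<Sum>j\<in>?N r. grid_weight M j)"
      by (simp add: sum_over_range[OF inj])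
    show "0 \<le> (Z $ r)\<^sup>2 / ?w r" using w[of r] by simp
  qed
  finally have cross: "(\<Sum>r\<in>UNIV. Z $ r * (\<Sum>j\<in>?N r. grid_value \<nu> Z j)) \<le>
    (\<Sum>r\<in>UNIV. (Z $ r)\<^sup>2 / ?w r * (\<Sum>j\<in>?N r. grid_weight M j))" .
  have ws: "(\<Sum>j\<in>?N r. grid_weight M j) = real (card (?N r)) * ?w r - 2" for r
    using sum_grid_weight_neighbours[OF int \<open>d \<ge> 1\<close>, of r] by (simp add: sum_subtractf)
  have "Z \<bullet> (discrete_laplacian M \<nu> *v Z) =
      (real M)\<^sup>2 * (\<Sum>r\<in>UNIV. Z $ r * (\<Sum>j\<in>?N r. grid_value \<nu> Z j - Z $ r))"
    by (simp add: discrete_laplacian_mult_vec laplacian_stencil_def inner_vec_def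
        sum_distrib_left power_divide mult_ac)
  also have "(\<Sum>r\<in>UNIV. Z $ r * (\<Sum>j\<in>?N r. grid_value \<nu> Z j - Z $ r)) =
      (\<Sum>r\<in>UNIV. Z $ r * (\<Sum>j\<in>?N r. grid_value \<nu> Z j)) - (\<Sum>r\<in>UNIV. real (card (?N r)) * (Z $ r)\<^sup>2)"
    by (simp add: sum_subtractf power2_eq_square algebra_simps)
  also have "(real M)\<^sup>2 * \<dots> \<le> (real M)\<^sup>2 * (\<Sum>r\<in>UNIV. - 2 * (Z $ r)\<^sup>2 / ?w r)"
  proof (rule mult_left_mono)
    \<comment> \<open>By \<open>ws\<close> the weight reproduces the diagonal term, whatever the
      number of neighbours, up to the defect coming from \<open>- 2\<close>.\<close>
    have "(Z $ r)\<^sup>2 / ?w r * (\<Sum>j\<in>?N r. grid_weight M j) =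
        real (card (?N r)) * (Z $ r)\<^sup>2 + - 2 * (Z $ r)\<^sup>2 / ?w r" for r
      using w[of r] by (simp add: ws field_simps)
    with cross show "(\<Sum>r\<in>UNIV. Z $ r * (\<Sum>j\<in>?N r. grid_value \<nu> Z j)) - (\<Sum>r\<in>UNIV. real (card (?N r)) * (Z $ r)\<^sup>2)
        \<le> (\<Sum>r\<in>UNIV. - 2 * (Z $ r)\<^sup>2 / ?w r)"
      by (simp only: sum.distrib)
  qed simp
  also have "\<dots> \<le> (\<Sum>r\<in>UNIV. - 2 * (Z $ r)\<^sup>2)"
  proof -
    have "2 * (Z $ r)\<^sup>2 \<le> 2 * ((real M)\<^sup>2 * (Z $ r)\<^sup>2) / ?w r" for r
      using w[of r] mult_right_mono[of "?w r" "(real M)\<^sup>2" "(Z $ r)\<^sup>2"]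
      by (simp add: field_simps)
    then show ?thesis by (subst sum_distrib_left) (intro sum_mono, simp add: algebra_simps)
  qed
  also have "\<dots> = - 2 * (Z \<bullet> Z)"
    by (simp add: inner_vec_def power2_eq_square sum_distrib_left)
  finally show ?thesis .
qed

section \<open>Convergence\<close>

lemma tendsto_of_sum_squares_le:
  fixes x z :: "nat \<Rightarrow> 'a::real_inner"
  assumes le: "\<And>k. (x k - a) \<bullet> (x k - a) + (z k - b) \<bullet> (z k - b) \<le> C * s k" and s: "s \<longlonglongrightarrow> 0"
  shows "x \<longlonglongrightarrow> a \<and> z \<longlonglongrightarrow> b"
proof -
  have "(\<lambda>k. sqrt (C * s k)) \<longlonglongrightarrow> sqrt (C * 0)"
    by (intro tendsto_intros s)
  then have lim: "(\<lambda>k. sqrt (C * s k)) \<longlonglongrightarrow> 0" by simp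
  have "norm (x k - a) \<le> sqrt (C * s k)" "norm (z k - b) \<le> sqrt (C * s k)" for k
    using le[of k] by (auto intro!: real_le_rsqrt simp: power2_norm_eq_inner intro: order_trans[rotated])
  then show ?thesis
    using lim by (auto intro!: LIM_zero_cancel[of _ a] LIM_zero_cancel[of _ b] Lim_null_comparison[OF _ lim])
qed

theorem theorem4p2:
  fixes d M :: nat and \<nu> :: "'n::finite \<Rightarrow> nat list"
    and T T\<^sub>1 \<gamma> :: real
    and f g y p :: "real \<Rightarrow> real ^ 'n"
    and y\<^sub>0 p_init :: "real ^ 'n"
    and y\<^sub>1 p\<^sub>1 y\<^sub>2 p\<^sub>2 :: "nat \<Rightarrow> real \<Rightarrow> real ^ 'n"
  assumes "d \<in> {1, 2, 3}" and "M \<ge> 2"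
    and "bij_betw \<nu> UNIV (interior_grid d M)"
    and "T > 0" and "T\<^sub>1 \<in> {0<..<T}" and "\<gamma> > 0"
    and "square_integrable_on f {0<..<T}" and "square_integrable_on g {0<..<T}"
    and "optimality_solution (discrete_laplacian M \<nu>) \<gamma> f g 0 T y p"
    and "y 0 = y\<^sub>0" and "p T = 0"
    and "p\<^sub>2 0 T\<^sub>1 = p_init"
    and "\<And>k. k \<ge> 1 \<Longrightarrow>
           optimality_solution (discrete_laplacian M \<nu>) \<gamma> f g 0 T\<^sub>1 (y\<^sub>1 k) (p\<^sub>1 k) \<and>
           y\<^sub>1 k 0 = y\<^sub>0 \<and> p\<^sub>1 k T\<^sub>1 = p\<^sub>2 (k - 1) T\<^sub>1"
    and "\<And>k. k \<ge> 1 \<Longrightarrow>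
           optimality_solution (discrete_laplacian M \<nu>) \<gamma> f g T\<^sub>1 T (y\<^sub>2 k) (p\<^sub>2 k) \<and>
           y\<^sub>2 k T\<^sub>1 = y\<^sub>1 k T\<^sub>1 \<and> p\<^sub>2 k T = 0"
  shows "(\<forall>t\<in>{0..T\<^sub>1}. (\<lambda>k. y\<^sub>1 k t) \<longlonglongrightarrow> y t \<and> (\<lambda>k. p\<^sub>1 k t) \<longlonglongrightarrow> p t) \<and>
         (\<forall>t\<in>{T\<^sub>1..T}. (\<lambda>k. y\<^sub>2 k t) \<longlonglongrightarrow> y t \<and> (\<lambda>k. p\<^sub>2 k t) \<longlonglongrightarrow> p t)"
proof -
  let ?L = "discrete_laplacian M \<nu>"
  have T1: "0 < T\<^sub>1" "T\<^sub>1 < T" using assms(5) by auto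
  have "d \<ge> 1" using assms(1) by auto
  note coercive = discrete_laplacian_coercive[OF assms(3) \<open>d \<ge> 1\<close>]
  \<comment> \<open>The iterates are solutions from index 1 on, hence the shift to
    \<open>Suc k\<close>; the initial guess is the value of \<open>p\<^sub>2 0\<close> at
    \<open>T\<^sub>1\<close>.\<close>
  have sol1: "homogeneous_solution ?L \<gamma> 0 T\<^sub>1 (\<lambda>t. y\<^sub>1 (Suc k) t - y t) (\<lambda>t. p\<^sub>1 (Suc k) t - p t)" for k
    using assms(13)[of "Suc k"] T1 by (intro optimality_solution_diff[OF assms(9)]) auto
  have sol2: "homogeneous_solution ?L \<gamma> T\<^sub>1 T (\<lambda>t. y\<^sub>2 (Suc k) t - y t) (\<lambda>t. p\<^sub>2 (Suc k) t - p t)" for k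
    using assms(14)[of "Suc k"] T1 by (intro optimality_solution_diff[OF assms(9)]) auto
  have bdry1: "y\<^sub>1 (Suc k) 0 = y 0" "p\<^sub>1 (Suc k) T\<^sub>1 = p\<^sub>2 k T\<^sub>1" for k
    using assms(13)[of "Suc k"] assms(10) by auto
  have bdry2: "y\<^sub>2 (Suc k) T\<^sub>1 = y\<^sub>1 (Suc k) T\<^sub>1" "p\<^sub>2 (Suc k) T = p T" for k
    using assms(14)[of "Suc k"] assms(11) by auto
  \<comment> \<open>\<open>Q k\<close> is the adjoint error at the interface handed to iteration
    \<open>k + 1\<close>, and \<open>E k\<close> is the state error it produces there, so one sweep
    leads from \<open>Q k\<close> through \<open>E k\<close> to \<open>Q (Suc k)\<close>.\<close>
  define E where "E k = (y\<^sub>1 (Suc k) T\<^sub>1 - y T\<^sub>1) \<bullet> (y\<^sub>1 (Suc k) T\<^sub>1 - y T\<^sub>1)" for k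
  define Q where "Q k = (p\<^sub>2 k T\<^sub>1 - p T\<^sub>1) \<bullet> (p\<^sub>2 k T\<^sub>1 - p T\<^sub>1)" for k
  have Q0: "0 \<le> Q k" and E0: "0 \<le> E k" for k by (simp_all add: Q_def E_def)
  \<comment> \<open>Coercivity holds with \<open>\<mu> = 2\<close>; the remaining requirement
    \<open>c \<le> \<mu> / 2\<close> follows from \<open>c \<le> 1 / 2\<close>.\<close>
  define c where "c = min (1 / 2) (2 * \<gamma>)"
  have c: "0 < c" "c \<le> 1 / 2" "c \<le> 2 * \<gamma>" using \<open>\<gamma> > 0\<close> by (auto simp: c_def)
  define \<rho> where "\<rho> = (1 - c) / (1 + c)"
  have \<rho>: "0 \<le> \<rho>" "\<rho> < 1" using c by (auto simp: \<rho>_def)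
  have E_le: "E k \<le> \<rho> / \<gamma> * Q k" for k
  proof -
    \<comment> \<open>At time 0 only the adjoint part of the weighted energy remains, and it is
      nonpositive.\<close>
    have "(1 + c) * E k - (1 - c) * Q k / \<gamma> \<le>
        - ((1 - c) * ((p\<^sub>1 (Suc k) 0 - p 0) \<bullet> (p\<^sub>1 (Suc k) 0 - p 0)) / \<gamma>)"
      using weighted_energy_decreasing[OF sol1[of k] _ \<open>\<gamma> > 0\<close> coercive, of c] T1 c
      by (simp add: bdry1 E_def Q_def)
    also have "\<dots> \<le> 0" using c \<open>\<gamma> > 0\<close> by simp
    finally have "E k \<le> (1 - c) * Q k / \<gamma> / (1 + c)"
      using c by (simp add: pos_le_divide_eq mult_ac)
    then show ?thesis by (simp add: \<rho>_def mult_ac)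
  qed
  have Q_le: "Q (Suc k) \<le> \<gamma> * E k" for k
  proof -
    have "(y\<^sub>2 (Suc k) T - y T) \<bullet> (y\<^sub>2 (Suc k) T - y T) \<le> E k - Q (Suc k) / \<gamma>"
      using weighted_energy_decreasing[OF sol2[of k] _ \<open>\<gamma> > 0\<close> coercive, of 0] T1 \<open>\<gamma> > 0\<close>
      by (simp add: bdry2 E_def Q_def)
    then have "0 \<le> E k - Q (Suc k) / \<gamma>" using inner_ge_zero order_trans by blast
    then show ?thesis using \<open>\<gamma> > 0\<close> by (simp add: field_simps)
  qed
  have "Q k \<le> Q 0 * \<rho> ^ k" for k
  proof (induction k)
    case (Suc k)
    \<comment> \<open>The factors \<gamma> of the two half-steps cancel, leaving the rate
      \<rho>.\<close>
    have "Q (Suc k) \<le> \<gamma> * (\<rho> / \<gamma> * Q k)"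
      using Q_le[of k] mult_left_mono[OF E_le[of k], of \<gamma>] \<open>\<gamma> > 0\<close> by linarith
    also have "\<dots> = \<rho> * Q k" using \<open>\<gamma> > 0\<close> by simp
    also have "\<dots> \<le> \<rho> * (Q 0 * \<rho> ^ k)" using Suc \<rho> by (intro mult_left_mono)
    finally show ?case by (simp add: mult_ac)
  qed simp
  moreover have "(\<lambda>k. Q 0 * \<rho> ^ k) \<longlonglongrightarrow> 0"
    using \<rho> by (intro tendsto_mult_right_zero LIMSEQ_power_zero) auto
  ultimately have Q_lim: "Q \<longlonglongrightarrow> 0"
    using Q0 by (intro Lim_null_comparison[of Q]) auto
  have E_lim: "E \<longlonglongrightarrow> 0"
    using E0 E_le tendsto_mult_right_zero[OF Q_lim, of "\<rho> / \<gamma>"]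
    by (intro Lim_null_comparison[of E]) auto
  obtain K where K: "\<And>a b e q. homogeneous_solution ?L \<gamma> a b e q \<Longrightarrow> a \<le> b \<Longrightarrow>
      e b \<bullet> e b + q b \<bullet> q b \<le> exp (K * (b - a)) * (e a \<bullet> e a + q a \<bullet> q a) \<and>
      e a \<bullet> e a + q a \<bullet> q a \<le> exp (K * (b - a)) * (e b \<bullet> e b + q b \<bullet> q b)"
    using homogeneous_solution_growth[OF \<open>\<gamma> > 0\<close>] by metis
  \<comment> \<open>In iteration \<open>k + 1\<close> the subdomains have different adjoint errors
    at \<open>T\<^sub>1\<close>: the old \<open>Q k\<close> on the left, the new
    \<open>Q (Suc k)\<close> on the right.\<close>
  have lim1: "(\<lambda>k. E k + Q k) \<longlonglongrightarrow> 0" and lim2: "(\<lambda>k. E k + Q (Suc k)) \<longlonglongrightarrow> 0"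
    using tendsto_add_zero[OF E_lim Q_lim] tendsto_add_zero[OF E_lim LIMSEQ_Suc[OF Q_lim]] by auto
  show ?thesis
  proof (intro conjI[where P = "\<forall>t\<in>_. _ t"] ballI)
    fix t assume t: "t \<in> {0..T\<^sub>1}"
    have "(\<lambda>k. y\<^sub>1 (Suc k) t) \<longlonglongrightarrow> y t \<and> (\<lambda>k. p\<^sub>1 (Suc k) t) \<longlonglongrightarrow> p t"
    proof (rule tendsto_of_sum_squares_le[OF _ lim1])
      \<comment> \<open>The growth bound is used backward from \<open>T\<^sub>1\<close> here, and
        forward on the second interval.\<close>
      show "(y\<^sub>1 (Suc k) t - y t) \<bullet> (y\<^sub>1 (Suc k) t - y t) + (p\<^sub>1 (Suc k) t - p t) \<bullet> (p\<^sub>1 (Suc k) t - p t)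
          \<le> exp (K * (T\<^sub>1 - t)) * (E k + Q k)" for k
        using K[OF homogeneous_solution_subset[OF sol1[of k], of t T\<^sub>1]] t
        by (simp add: E_def Q_def bdry1)
    qed
    then show "(\<lambda>k. y\<^sub>1 k t) \<longlonglongrightarrow> y t \<and> (\<lambda>k. p\<^sub>1 k t) \<longlonglongrightarrow> p t"
      by (auto intro: LIMSEQ_imp_Suc)
  next
    fix t assume t: "t \<in> {T\<^sub>1..T}"
    have "(\<lambda>k. y\<^sub>2 (Suc k) t) \<longlonglongrightarrow> y t \<and> (\<lambda>k. p\<^sub>2 (Suc k) t) \<longlonglongrightarrow> p t"
    proof (rule tendsto_of_sum_squares_le[OF _ lim2])
      show "(y\<^sub>2 (Suc k) t - y t) \<bullet> (y\<^sub>2 (Suc k) t - y t) + (p\<^sub>2 (Suc k) t - p t) \<bullet> (p\<^sub>2 (Suc k) t - p t)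
          \<le> exp (K * (t - T\<^sub>1)) * (E k + Q (Suc k))" for k
        using K[OF homogeneous_solution_subset[OF sol2[of k], of T\<^sub>1 t]] t
        by (simp add: E_def Q_def bdry2)
    qed
    then show "(\<lambda>k. y\<^sub>2 k t) \<longlonglongrightarrow> y t \<and> (\<lambda>k. p\<^sub>2 k t) \<longlonglongrightarrow> p t"
      by (auto intro: LIMSEQ_imp_Suc)
  qed
qed

end
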